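(* For every integer $s\ge1$, \[ 2( - 1)^{s + 1}\sum_{\mu = 1}^\infty \frac{H_\mu }{\mu ^{2s + 1} } = \zeta (s + 1)^2 + 2\sum_{i = 1}^{s - 1} ( - 1)^i \zeta (s - i + 1)\zeta (s + i + 1), \] or equivalently \[ 2\sum_{\mu = 1}^\infty \frac{H_\mu }{\mu ^{2s + 1} } = ( - 1)^{s - 1} \zeta (s + 1)^2 + 2\sum_{i = 0}^{s - 2} ( - 1)^i \zeta (i + 2)\zeta (2s - i). \]
   Context: $H_\mu=\sum_{k=1}^\mu 1/k$ is the $\mu$-th harmonic number and $\zeta$ the Riemann zeta function. Empty sums are zero. *)

theory Defs
  imports "HOL-Analysis.Analysis"
begin

(* The Dirichlet series converges, and hence gives the Riemann zeta function, exactly for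
   Re s > 1. Outside this half-plane the value of the constant below is meaningless: it is not
   the analytic continuation. *)
definition riemann_zeta :: "complex \<Rightarrow> complex" where
  "riemann_zeta s = (\<Sum>n. 1 / of_nat (Suc n) powr s)"

end

theory Submission
  imports Defs
begin

text \<open>
  Let \<open>T(a, b)\<close> be the sum of \<open>1 / (m\<^sup>a n\<^sup>b (m + n))\<close> over all \<open>m, n \<ge> 1\<close>. Telescoping
  \<open>1/n - 1/(m + n)\<close> over \<open>n\<close> gives \<open>H\<^sub>m\<close>, so the harmonic series is \<open>T(2s, 1)\<close>. Writing
  \<open>1 = (m + n)/(m + n)\<close> gives \<open>\<zeta>(a + 1) \<zeta>(b + 1) = T(a, b + 1) + T(a + 1, b)\<close>. Applying this
  \<open>s - 1\<close> times turns \<open>T(2s, 1)\<close> into an alternating sum of zeta products plus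
  \<open>\<plusminus>T(s + 1, s)\<close>, and by the symmetry of \<open>T\<close> the next instance reads
  \<open>\<zeta>(s + 1)\<^sup>2 = 2 T(s + 1, s)\<close>.
\<close>

definition tornheim_term :: "nat \<Rightarrow> nat \<Rightarrow> nat \<times> nat \<Rightarrow> real" where
  "tornheim_term a b =
     (\<lambda>(m, n). 1 / (real (Suc m) ^ a * real (Suc n) ^ b * (real (Suc m) + real (Suc n))))"

text \<open>The Mordell-Tornheim double series with third exponent 1. Unordered summation makes
  swapping the variables a mere reindexing and allows summation row by row.\<close>

definition tornheim :: "nat \<Rightarrow> nat \<Rightarrow> real" where
  "tornheim a b = infsum (tornheim_term a b) UNIV"

text \<open>A real-valued zeta at integers, because nonnegative terms turn ordinary convergence into
  unconditional summability; \<open>riemann_zeta_of_nat\<close> carries the values over to the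
  complex numbers.\<close>

definition zeta_nat :: "nat \<Rightarrow> real" where
  "zeta_nat a = (\<Sum>n. 1 / real (Suc n) ^ a)"

lemma summable_inverse_power_Suc:
  assumes "a \<ge> 2"
  shows "summable (\<lambda>n. 1 / real (Suc n) ^ a)"
proof -
  have "summable (\<lambda>n. inverse (real (Suc n) ^ a))"
    by (subst summable_Suc_iff) (rule inverse_power_summable[OF assms])
  then show ?thesis
    by (simp add: inverse_eq_divide)
qed

lemma has_sum_zeta_nat:
  assumes "a \<ge> 2"
  shows "((\<lambda>n. 1 / real (Suc n) ^ a) has_sum zeta_nat a) UNIV"
  using summable_sums[OF summable_inverse_power_Suc[OF assms]]
  unfolding zeta_nat_def by (intro sums_nonneg_imp_has_sum) auto

lemma riemann_zeta_of_nat: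
  assumes "a \<ge> 2"
  shows "riemann_zeta (of_nat a) = of_real (zeta_nat a)"
proof -
  have "riemann_zeta (of_nat a) = (\<Sum>n. of_real (1 / real (Suc n) ^ a))"
    unfolding riemann_zeta_def using assms
    by (intro arg_cong[where f = suminf] ext, subst powr_nat') (auto simp del: of_nat_Suc)
  also have "\<dots> = of_real (zeta_nat a)"
    unfolding zeta_nat_def by (rule suminf_of_real[OF summable_inverse_power_Suc[OF assms], symmetric])
  finally show ?thesis .
qed

text \<open>Tonelli: for nonnegative terms it is enough that the rows are summable and that the row
  sums are.\<close>

lemma summable_on_product_nonneg:
  fixes f g :: "nat \<Rightarrow> real"
  assumes f: "f summable_on UNIV" and g: "g summable_on UNIV"
    and f0: "\<And>x. f x \<ge> 0" and g0: "\<And>x. g x \<ge> 0"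
  shows "(\<lambda>(x, y). f x * g y) summable_on UNIV"
proof -
  have "(\<lambda>(x, y). f x * g y) summable_on (SIGMA x:UNIV. UNIV)"
  proof (rule summable_on_SigmaI)
    show "((\<lambda>y. case (x, y) of (x, y) \<Rightarrow> f x * g y) has_sum f x * infsum g UNIV) UNIV" for x
      using has_sum_cmult_right[OF has_sum_infsum[OF g], of "f x"] by simp
    show "(\<lambda>x. f x * infsum g UNIV) summable_on UNIV"
      by (rule summable_on_cmult_left[OF f])
  qed (use f0 g0 in auto)
  then show ?thesis
    by simp
qed

text \<open>The worst case is \<open>a = b = 1\<close>. There \<open>x + y\<close> dominates
  \<open>sqrt x * sqrt y\<close> by the AM-GM inequality, so the terms are bounded by a product of
  two series with exponent 3/2.\<close>

lemma summable_on_tornheim_term: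
  assumes "a \<ge> 1" "b \<ge> 1"
  shows "tornheim_term a b summable_on UNIV"
proof -
  define f where "f n = 1 / (real (Suc n) * sqrt (real (Suc n)))" for n
  have f_powr: "f n = real (Suc n) powr (- 3 / 2)" for n
  proof -
    have "real (Suc n) powr (3 / 2) = real (Suc n) powr (1 + 1 / 2)"
      by simp
    also have "\<dots> = real (Suc n) * sqrt (real (Suc n))"
      by (simp only: powr_add powr_half_sqrt) simp
    finally show ?thesis
      unfolding f_def by (simp add: powr_minus_divide)
  qed
  have "summable (\<lambda>n. real (Suc n) powr (- 3 / 2))"
    by (subst summable_Suc_iff[of "\<lambda>n. real n powr (- 3 / 2)"]) (simp add: summable_real_powr_iff)
  then have "summable f"
    by (simp only: f_powr[symmetric])
  then have f: "f summable_on UNIV"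
    by (rule summable_nonneg_imp_summable_on) (simp add: f_def)
  have "(\<lambda>(m, n). f m * f n) summable_on UNIV"
    by (rule summable_on_product_nonneg[OF f f]) (simp_all add: f_def)
  then show ?thesis
  proof (rule summable_on_comparison_test)
    fix p :: "nat \<times> nat"
    obtain m n where p: "p = (m, n)"
      by (cases p)
    define x y where "x = real (Suc m)" and "y = real (Suc n)"
    have xy: "x \<ge> 1" "y \<ge> 1"
      by (auto simp: x_def y_def)
    have "sqrt x * sqrt y \<le> x + y"
      using arith_geo_mean_sqrt[of x y] xy by (simp add: real_sqrt_mult)
    moreover have "x \<le> x ^ a" "y \<le> y ^ b"
      using power_increasing[OF assms(1) xy(1)] power_increasing[OF assms(2) xy(2)] by simp_all
    ultimately have "(x * y) * (sqrt x * sqrt y) \<le> (x ^ a * y ^ b) * (x + y)"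
      using xy by (intro mult_mono) auto
    then have "1 / ((x ^ a * y ^ b) * (x + y)) \<le> 1 / ((x * y) * (sqrt x * sqrt y))"
      using xy by (intro divide_left_mono) auto
    then show "tornheim_term a b p \<le> (case p of (m, n) \<Rightarrow> f m * f n)"
      unfolding p tornheim_term_def f_def x_def[symmetric] y_def[symmetric] prod.case
      by (simp add: x_def y_def mult_ac)
    show "0 \<le> tornheim_term a b p"
      by (simp add: p tornheim_term_def)
  qed
qed

lemma has_sum_tornheim:
  assumes "a \<ge> 1" "b \<ge> 1"
  shows "(tornheim_term a b has_sum tornheim a b) UNIV"
  unfolding tornheim_def by (intro has_sum_infsum summable_on_tornheim_term assms)

lemma tornheim_commute: "tornheim a b = tornheim b a"
proof -
  have "tornheim b a = (\<Sum>\<^sub>\<infinity>p. tornheim_term b a (prod.swap p))"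
    unfolding tornheim_def by (rule infsum_reindex_bij_betw[symmetric]) simp
  also have "\<dots> = tornheim a b"
    unfolding tornheim_def
    by (intro infsum_cong) (auto simp: tornheim_term_def mult_ac add_ac)
  finally show ?thesis
    by simp
qed

lemma zeta_nat_mult:
  assumes "a \<ge> 1" "b \<ge> 1"
  shows "zeta_nat (a + 1) * zeta_nat (b + 1) = tornheim a (b + 1) + tornheim (a + 1) b"
proof -
  let ?h = "\<lambda>(m, n). 1 / real (Suc m) ^ (a + 1) * (1 / real (Suc n) ^ (b + 1))"
  have eq: "tornheim_term a (b + 1) p + tornheim_term (a + 1) b p = ?h p" for p
  proof -
    obtain m n where p: "p = (m, n)"
      by (cases p)
    define x y where "x = real (Suc m)" and "y = real (Suc n)"
    have "x > 0" "y > 0"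
      by (auto simp: x_def y_def)
    \<comment> \<open>Over the common denominator the two numerators add up to \<open>x + y\<close>,
      which cancels.\<close>
    then have "1 / (x ^ a * y ^ (b + 1) * (x + y)) + 1 / (x ^ (a + 1) * y ^ b * (x + y))
                 = 1 / x ^ (a + 1) * (1 / y ^ (b + 1))"
      by (simp add: divide_simps)
    then show ?thesis
      by (simp add: p tornheim_term_def x_def y_def)
  qed
  have "((\<lambda>p. tornheim_term a (b + 1) p + tornheim_term (a + 1) b p) has_sum
           (tornheim a (b + 1) + tornheim (a + 1) b)) UNIV"
    using assms by (intro has_sum_add has_sum_tornheim) auto
  then have "(?h has_sum (tornheim a (b + 1) + tornheim (a + 1) b)) (UNIV \<times> UNIV)"
    unfolding eq by simp
  \<comment> \<open>Summing by rows gives a series in \<open>m\<close> whose value is also the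
    product of the two zeta values; uniqueness of sums then identifies both.\<close>
  then have "((\<lambda>m. 1 / real (Suc m) ^ (a + 1) * zeta_nat (b + 1)) has_sum
          (tornheim a (b + 1) + tornheim (a + 1) b)) UNIV"
  proof (rule has_sum_SigmaD)
    show "((\<lambda>n. ?h (m, n)) has_sum 1 / real (Suc m) ^ (a + 1) * zeta_nat (b + 1)) UNIV" for m
      unfolding prod.case using assms by (intro has_sum_cmult_right has_sum_zeta_nat) simp
  qed
  moreover have "((\<lambda>m. 1 / real (Suc m) ^ (a + 1) * zeta_nat (b + 1)) has_sum
                   zeta_nat (a + 1) * zeta_nat (b + 1)) UNIV"
    using assms by (intro has_sum_cmult_left has_sum_zeta_nat) auto
  ultimately show ?thesis
    by (metis has_sum_unique)
qed

text \<open>Raising \<open>m\<close> by one adds the series of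
  \<open>1/(n + m + 1) - 1/(n + m + 2)\<close> over n \<ge> 0, which telescopes to
  \<open>1/(m + 1)\<close>.\<close>

lemma sums_harm: "(\<lambda>n. 1 / real (Suc n) - 1 / real (Suc n + m)) sums harm m"
proof (induction m)
  case 0
  show ?case
    by (simp add: harm_def)
next
  case (Suc m)
  have "(\<lambda>n. 1 / real (n + Suc m)) \<longlonglongrightarrow> 0"
    using LIMSEQ_ignore_initial_segment[OF lim_1_over_n, of "Suc m"] by simp
  from telescope_sums'[OF this]
  have "(\<lambda>n. 1 / real (Suc n + m) - 1 / real (Suc n + Suc m)) sums (1 / real (Suc m))"
    by simp
  from sums_add[OF Suc this] show ?case
    by (simp add: harm_Suc inverse_eq_divide)
qed

text \<open>Partial fractions in \<open>y\<close>: \<open>1/(y * (x + y))\<close> equals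
  \<open>(1/y - 1/(y + x)) / x\<close>. The extra \<open>x\<close> raises the exponent to
  \<open>a + 1\<close>.\<close>

lemma has_sum_tornheim_term_1:
  assumes "a \<ge> 1"
  shows "((\<lambda>n. tornheim_term a 1 (m, n)) has_sum harm (Suc m) / real (Suc m) ^ (a + 1)) UNIV"
proof -
  have eq: "(1 / real (Suc n) - 1 / real (Suc n + Suc m)) / real (Suc m) ^ (a + 1)
              = tornheim_term a 1 (m, n)" for n
  proof -
    define x y where "x = real (Suc m)" and "y = real (Suc n)"
    have "x > 0" "y > 0"
      by (auto simp: x_def y_def)
    then have "(1 / y - 1 / (y + x)) / x ^ (a + 1) = 1 / (x ^ a * y ^ 1 * (x + y))"
      by (simp add: divide_simps)
    then show ?thesis
      by (simp add: tornheim_term_def x_def y_def)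
  qed
  show ?thesis
    using sums_divide[OF sums_harm[of "Suc m"], of "real (Suc m) ^ (a + 1)"]
    unfolding eq by (intro sums_nonneg_imp_has_sum) (auto simp: tornheim_term_def)
qed

lemma sums_harm_over_power:
  assumes "a \<ge> 1"
  shows "(\<lambda>n. harm (Suc n) / real (Suc n) ^ (a + 1)) sums tornheim a 1"
proof (rule has_sum_imp_sums, rule has_sum_SigmaD)
  show "(tornheim_term a 1 has_sum tornheim a 1) (UNIV \<times> UNIV)"
    using has_sum_tornheim[of a 1] assms by simp
qed (rule has_sum_tornheim_term_1[OF assms])

text \<open>Each step trades \<open>tornheim (c - r) (r + 1)\<close> for a zeta product minus the
  series with one unit of exponent moved to the second variable; \<open>r < c\<close> keeps the
  first exponent positive.\<close>

lemma tornheim_1_expand: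
  assumes "r < c"
  shows "tornheim c 1 = (\<Sum>i<r. (-1) ^ i * zeta_nat (i + 2) * zeta_nat (c - i))
                          + (-1) ^ r * tornheim (c - r) (r + 1)"
  using assms
proof (induction r)
  case 0
  show ?case
    by simp
next
  case (Suc r)
  have "zeta_nat (c - r) * zeta_nat (r + 2)
          = tornheim (c - Suc r) (r + 2) + tornheim (c - r) (r + 1)"
    using zeta_nat_mult[of "c - Suc r" "r + 1"] Suc.prems by (simp add: Suc_diff_Suc)
  then have "tornheim (c - r) (r + 1)
               = zeta_nat (r + 2) * zeta_nat (c - r) - tornheim (c - Suc r) (Suc r + 1)"
    by (simp add: mult.commute)
  with Suc show ?case
    by (simp add: right_diff_distrib mult.assoc)
qed

lemma tornheim_even_1:
  assumes "s \<ge> 1"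
  shows "2 * tornheim (2 * s) 1 = (-1) ^ (s - 1) * zeta_nat (s + 1) ^ 2
           + 2 * (\<Sum>i<s - 1. (-1) ^ i * zeta_nat (i + 2) * zeta_nat (2 * s - i))"
proof -
  have "zeta_nat (s + 1) ^ 2 = 2 * tornheim (s + 1) s"
    using zeta_nat_mult[of s s] tornheim_commute[of s "s + 1"] assms by (simp add: power2_eq_square)
  \<comment> \<open>Stopping the expansion at \<open>r = s - 1\<close> leaves exactly the remainder
    \<open>tornheim (s + 1) s\<close>, whose double is the square just found.\<close>
  moreover have "2 * s - (s - 1) = s + 1" "s - 1 + 1 = s" "s - 1 < 2 * s"
    using assms by auto
  ultimately show ?thesis
    using tornheim_1_expand[of "s - 1" "2 * s"] by simp
qed

text \<open>Links the two forms of the zeta sum: the reflection of \<open>i\<close> to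
  \<open>s - 1 - i\<close> is its own inverse and exchanges the two index ranges.\<close>

lemma alternating_sum_reflect:
  fixes f :: "nat \<Rightarrow> nat \<Rightarrow> 'a :: comm_ring_1"
  assumes "s \<ge> 1"
  shows "(-1) ^ (s + 1) * (\<Sum>i<s - 1. (-1) ^ i * f (i + 2) (2 * s - i))
           = (\<Sum>i = 1..s - 1. (-1) ^ i * f (s - i + 1) (s + i + 1))"
proof -
  have "(-1) ^ (s + 1) * (\<Sum>i<s - 1. (-1) ^ i * f (i + 2) (2 * s - i))
          = (\<Sum>i<s - 1. (-1) ^ (s + 1 + i) * f (i + 2) (2 * s - i))"
    by (simp only: sum_distrib_left power_add mult.assoc)
  also have "\<dots> = (\<Sum>i = 1..s - 1. (-1) ^ i * f (s - i + 1) (s + i + 1))"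
  proof (rule sum.reindex_bij_witness[of _ "\<lambda>i. s - 1 - i" "\<lambda>i. s - 1 - i"])
    fix i assume "i \<in> {..<s - 1}"
    then have i: "i < s - 1"
      by simp
    \<comment> \<open>The exponents differ by an even number, so the signs agree.\<close>
    then have "s + 1 + i = (s - 1 - i) + 2 * (i + 1)"
      by simp
    then have "(-1 :: 'a) ^ (s + 1 + i) = (-1) ^ (s - 1 - i)"
      by (simp only: power_add power_mult) simp
    moreover have "s - (s - 1 - i) + 1 = i + 2" "s + (s - 1 - i) + 1 = 2 * s - i"
      using i by auto
    ultimately show "(-1) ^ (s - 1 - i) * f (s - (s - 1 - i) + 1) (s + (s - 1 - i) + 1)
        = (-1) ^ (s + 1 + i) * f (i + 2) (2 * s - i)"
      by (simp only:)
  qed auto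
  finally show ?thesis .
qed

theorem theorem5p6:
  fixes s :: nat
  assumes "s \<ge> 1"
  shows "summable (\<lambda>n. harm (Suc n) / of_nat (Suc n) ^ (2 * s + 1) :: complex) \<and>
    2 * (-1) ^ (s + 1) * (\<Sum>n. harm (Suc n) / of_nat (Suc n) ^ (2 * s + 1))
      = riemann_zeta (of_nat (s + 1)) ^ 2
        + 2 * (\<Sum>i = 1..s - 1. (-1) ^ i * riemann_zeta (of_nat (s - i + 1))
                                        * riemann_zeta (of_nat (s + i + 1))) \<and>
    2 * (\<Sum>n. harm (Suc n) / of_nat (Suc n) ^ (2 * s + 1))
      = (-1) ^ (s - 1) * riemann_zeta (of_nat (s + 1)) ^ 2
        + 2 * (\<Sum>i<s - 1. (-1) ^ i * riemann_zeta (of_nat (i + 2))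
                                    * riemann_zeta (of_nat (2 * s - i)))"
proof -
  let ?S = "\<Sum>n. harm (Suc n) / of_nat (Suc n) ^ (2 * s + 1) :: complex"
  let ?Z = "\<lambda>a. riemann_zeta (of_nat a)"
  have "(\<lambda>n. of_real (harm (Suc n) / real (Suc n) ^ (2 * s + 1)) :: complex)
          sums of_real (tornheim (2 * s) 1)"
    using assms by (intro sums_of_real sums_harm_over_power) simp
  then have sums: "(\<lambda>n. harm (Suc n) / of_nat (Suc n) ^ (2 * s + 1) :: complex)
          sums of_real (tornheim (2 * s) 1)"
    by (simp only: of_real_divide of_real_harm of_real_power of_real_of_nat_eq)
  \<comment> \<open>For \<open>i < s - 1\<close> both arguments \<open>i + 2\<close> and
    \<open>2 * s - i\<close> are at least 2, so every zeta value is a convergent series.\<close>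
  have "(\<Sum>i<s - 1. (-1) ^ i * ?Z (i + 2) * ?Z (2 * s - i))
          = of_real (\<Sum>i<s - 1. (-1) ^ i * zeta_nat (i + 2) * zeta_nat (2 * s - i))"
    unfolding of_real_sum by (intro sum.cong refl) (subst (1 2) riemann_zeta_of_nat; simp)
  moreover have "?Z (s + 1) = of_real (zeta_nat (s + 1))"
    using assms by (intro riemann_zeta_of_nat) simp
  moreover have "2 * ?S = of_real (2 * tornheim (2 * s) 1)"
    using sums_unique[OF sums] by simp
  ultimately have second: "2 * ?S = (-1) ^ (s - 1) * ?Z (s + 1) ^ 2
          + 2 * (\<Sum>i<s - 1. (-1) ^ i * ?Z (i + 2) * ?Z (2 * s - i))"
    unfolding tornheim_even_1[OF assms] by simp
  \<comment> \<open>The exponents add up to \<open>2 * s\<close>. Multiplying the second form by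
    \<open>(-1) ^ (s + 1)\<close> therefore clears the sign of the square, and reflecting the sum
    gives the first form.\<close>
  have sign: "(-1 :: complex) ^ (s + 1) * (-1) ^ (s - 1) = 1"
    using assms by (simp flip: power_add add: power_mult mult_2[symmetric])
  have "2 * (-1) ^ (s + 1) * ?S = (-1) ^ (s + 1) * (2 * ?S)"
    by (simp only: mult_ac)
  also have "\<dots> = ((-1) ^ (s + 1) * (-1) ^ (s - 1)) * ?Z (s + 1) ^ 2
      + 2 * ((-1) ^ (s + 1) * (\<Sum>i<s - 1. (-1) ^ i * (?Z (i + 2) * ?Z (2 * s - i))))"
    unfolding second by (simp only: distrib_left mult_ac)
  also have "\<dots> = ?Z (s + 1) ^ 2
      + 2 * (\<Sum>i = 1..s - 1. (-1) ^ i * ?Z (s - i + 1) * ?Z (s + i + 1))"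
    unfolding sign alternating_sum_reflect[OF assms, of "\<lambda>a b. ?Z a * ?Z b"]
    by (simp only: mult.assoc mult_1_left)
  finally show ?thesis
    using second sums_summable[OF sums] by blast
qed

end
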